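(* Let $P$ be a countable $\mathrm{I\overline{E}}$ poset which embeds $\mathrm{V}$, $\Lambda$ and $Z$. If $P$ is $\mathrm{I\overline{H}}$, then $P$ is $\mathrm{\overline{H}\,\overline{E}}$. If $P$ is $\mathrm{IH}$, then $P$ is $\mathrm{HE}$ and $\mathrm{MB}$.
   Context: Let $P$ be a poset; $x\parallel y$ means $x,y$ are incomparable. Finite partial maps are maps from a finite subset of $P$ to $P$. Kinds of finite partial map: $\mathrm{\overline{H}}$: preserves $\le$; $\mathrm{H}$: preserves $<$; $\mathrm{M}$: injective and preserves $<$; $\mathrm{I}$: an isomorphism between finite induced subposets. Kinds of total map $P\to P$: $\mathrm{\overline{H}}$: preserves $\le$; $\mathrm{H}$: preserves $<$; $\mathrm{\overline{E}}$: surjective and preserves $\le$; $\mathrm{E}$: surjective and preserves $<$; $\mathrm{B}$: bijective and preserves $<$. For a kind $X$ of finite partial map and a kind $Y$ of total map, $P$ is $XY$ if every finite partial map of kind $X$ on $P$ extends to a map $P\to P$ of kind $Y$. $\mathrm{V}$ is the 3-element poset with two incomparable elements both above a third; $\Lambda$ is the 3-element poset with two incomparable elements both below a third; $Z$ is the 3-element poset consisting of a 2-element chain and an element incomparable to both elements of that chain. "$P$ embeds $Q$" means $Q$ is isomorphic to an induced subposet of $P$. *)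

theory Defs
  imports "HOL-Library.Countable_Set"
begin

text \<open>
  A poset is a type of class \<open>order\<close>, passed to the definitions as \<open>TYPE('a)\<close>.
  A finite partial map is a finite domain \<open>F\<close> together with a function \<open>f\<close> of which
  only the values on \<open>F\<close> matter. A kind of map is a predicate on such maps.
\<close>

type_synonym 'a partial_kind = "'a set \<Rightarrow> ('a \<Rightarrow> 'a) \<Rightarrow> bool"
type_synonym 'a total_kind = "('a \<Rightarrow> 'a) \<Rightarrow> bool"

definition partial_Hbar :: "('a::order) partial_kind"
  where "partial_Hbar F f \<longleftrightarrow> mono_on F f"

definition partial_H :: "('a::order) partial_kind"
  where "partial_H F f \<longleftrightarrow> strict_mono_on F f"

definition partial_M :: "('a::order) partial_kind"
  where "partial_M F f \<longleftrightarrow> inj_on f F \<and> strict_mono_on F f"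

definition partial_I :: "('a::order) partial_kind"
  where "partial_I F f \<longleftrightarrow> bij_betw f F (f ` F) \<and> (\<forall>x\<in>F. \<forall>y\<in>F. x \<le> y \<longleftrightarrow> f x \<le> f y)"

definition total_Hbar :: "('a::order) total_kind"
  where "total_Hbar g \<longleftrightarrow> mono g"

definition total_H :: "('a::order) total_kind"
  where "total_H g \<longleftrightarrow> strict_mono g"

definition total_Ebar :: "('a::order) total_kind"
  where "total_Ebar g \<longleftrightarrow> surj g \<and> mono g"

definition total_E :: "('a::order) total_kind"
  where "total_E g \<longleftrightarrow> surj g \<and> strict_mono g"

definition total_B :: "('a::order) total_kind"
  where "total_B g \<longleftrightarrow> bij g \<and> strict_mono g"

definition is_XY :: "('a::order) itself \<Rightarrow> 'a partial_kind \<Rightarrow> 'a total_kind \<Rightarrow> bool"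
  where "is_XY P X Y \<longleftrightarrow>
    (\<forall>F f. finite F \<and> X F f \<longrightarrow> (\<exists>g. Y g \<and> (\<forall>x\<in>F. g x = f x)))"

text \<open>
  The small posets are given by their (reflexive) order relation, with carrier its field.
\<close>

definition poset_V :: "nat rel"
  where "poset_V = Id_on {0, 1, 2} \<union> {(0, 1), (0, 2)}"

definition poset_Lambda :: "nat rel"
  where "poset_Lambda = Id_on {0, 1, 2} \<union> {(1, 0), (2, 0)}"

definition poset_Z :: "nat rel"
  where "poset_Z = Id_on {0, 1, 2} \<union> {(0, 1)}"

lemma Field_small_posets:
  "Field poset_V = {0, 1, 2}" "Field poset_Lambda = {0, 1, 2}" "Field poset_Z = {0, 1, 2}"
  by (auto simp: poset_V_def poset_Lambda_def poset_Z_def Field_def)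

lemma Partial_order_small_posets:
  "Partial_order poset_V" "Partial_order poset_Lambda" "Partial_order poset_Z"
  unfolding Field_small_posets partial_order_on_def preorder_on_def refl_on_def
    trans_def antisym_def
  unfolding poset_V_def poset_Lambda_def poset_Z_def
  by (simp_all add: Id_on_iff) auto

definition embeds :: "('a::order) itself \<Rightarrow> 'b rel \<Rightarrow> bool"
  where "embeds P Q \<longleftrightarrow>
    (\<exists>(S :: 'a set) f. bij_betw f (Field Q) S \<and>
      (\<forall>x\<in>Field Q. \<forall>y\<in>Field Q. (x, y) \<in> Q \<longleftrightarrow> f x \<le> f y))"

end

theory Submission
  imports Defs
begin

text \<open>
  The embedded V and \<open>\<Lambda>\<close> make \<open>P\<close> directed in both directions, and surjectivity of the
  extensions rules out extreme elements. Every finite set \<open>F\<close> therefore lies strictly between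
  two points \<open>l < u\<close>; mapping the chain \<open>l < u\<close> onto the chain of Z and pulling back its third
  point gives a point incomparable to all of \<open>F\<close>, so in a back-and-forth construction the
  ``back'' steps are unobstructed. A ``forth'' step at \<open>x\<close> asks for a point between two finite
  sets. If some point has both an incomparable pair below it and one above it, homogeneity gives
  interpolation between any two finite sets; otherwise one of the two sets is always a chain,
  where the weaker interpolation between one point and a finite set suffices. In the strict case
  interpolation can be iterated, which provides infinitely many choices and hence injectivity.
\<close>

section \<open>Back-and-forth between countable sets\<close>

text \<open>Stages alternately put the next element of each enumeration into the domain and into the
  range; \<open>g\<close> is their limit. Keeping \<open>K\<close> on arbitrarily large domains
  \<open>F'\<close> lets properties that concern finitely many points at a time pass to
  \<open>g\<close>.\<close>

lemma back_and_forth: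
  fixes K :: "'a set \<Rightarrow> ('a \<Rightarrow> 'b) \<Rightarrow> bool"
  assumes "countable (UNIV :: 'a set)" "countable (UNIV :: 'b set)"
    and cong: "\<And>F f g. K F f \<Longrightarrow> (\<And>x. x \<in> F \<Longrightarrow> g x = f x) \<Longrightarrow> K F g"
    and fwd: "\<And>F f x. finite F \<Longrightarrow> K F f \<Longrightarrow> x \<notin> F \<Longrightarrow> \<exists>y. K (insert x F) (f(x := y))"
    and bwd: "\<And>F f y. finite F \<Longrightarrow> K F f \<Longrightarrow> y \<notin> f ` F \<Longrightarrow>
      \<exists>x. x \<notin> F \<and> K (insert x F) (f(x := y))"
    and init: "finite F0" "K F0 f0"
  shows "\<exists>g. surj g \<and> (\<forall>x\<in>F0. g x = f0 x) \<and> (\<forall>F. finite F \<longrightarrow> (\<exists>F'. F \<subseteq> F' \<and> K F' g))"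
proof -
  define e where "e = from_nat_into (UNIV :: 'a set)"
  define d where "d = from_nat_into (UNIV :: 'b set)"
  have e: "surj e" and d: "surj d"
    using assms(1,2) by (auto simp: e_def d_def range_from_nat_into)
  define good where "good s \<longleftrightarrow> finite (fst s) \<and> K (fst s) (snd s)" for s
  define ext where "ext s t \<longleftrightarrow> fst s \<subseteq> fst t \<and> (\<forall>x\<in>fst s. snd t x = snd s x)"
    for s t :: "'a set \<times> ('a \<Rightarrow> 'b)"
  have step: "\<exists>t. (good t) \<and> (ext s t \<and> e n \<in> fst t \<and> d n \<in> snd t ` fst t)" if "good s" for s n
  proof -
    obtain t where t: "good t" "ext s t" "e n \<in> fst t"
    proof (cases "e n \<in> fst s")
      case True
      then show ?thesis using that[of s] \<open>good s\<close> by (auto simp: ext_def)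
    next
      case False
      then obtain y where "K (insert (e n) (fst s)) ((snd s)(e n := y))"
        using fwd[of "fst s" "snd s" "e n"] \<open>good s\<close> by (auto simp: good_def)
      then show ?thesis
        using \<open>good s\<close> False
        by (intro that[of "(insert (e n) (fst s), (snd s)(e n := y))"]) (auto simp: good_def ext_def)
    qed
    show ?thesis
    proof (cases "d n \<in> snd t ` fst t")
      case True
      then show ?thesis using t by blast
    next
      case False
      then obtain x where "x \<notin> fst t" "K (insert x (fst t)) ((snd t)(x := d n))"
        using bwd[of "fst t" "snd t" "d n"] t(1) by (auto simp: good_def)
      then show ?thesis
        using t by (intro exI[of _ "(insert x (fst t), (snd t)(x := d n))"])
          (auto simp: good_def ext_def)
    qed
  qed
  \<comment> \<open>Stage \<open>n + 1\<close> has treated \<open>e n\<close> and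
    \<open>d n\<close>; the clause for \<open>n = 0\<close> pins the start of the chain.\<close>
  have "\<exists>s. \<forall>n. (good (s n) \<and> (n = 0 \<longrightarrow> s n = (F0, f0))) \<and>
      (ext (s n) (s (Suc n)) \<and> e n \<in> fst (s (Suc n)) \<and> d n \<in> snd (s (Suc n)) ` fst (s (Suc n)))"
    using step init by (intro dependent_nat_choice) (auto simp: good_def)
  then obtain s where s: "\<And>n. good (s n)" "s 0 = (F0, f0)" "\<And>n. ext (s n) (s (Suc n))"
      "\<And>n. e n \<in> fst (s (Suc n))" "\<And>n. d n \<in> snd (s (Suc n)) ` fst (s (Suc n))"
    by blast
  have ext: "ext (s m) (s n)" if "m \<le> n" for m n
    using that
  proof (induction n rule: dec_induct)
    case (step n)
    then show ?case using s(3)[of n] by (auto simp: ext_def subset_iff)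
  qed (simp add: ext_def)
  have "\<exists>n. x \<in> fst (s n)" for x
    using e s(4) by (metis surjD)
  then obtain N where N: "\<And>x. x \<in> fst (s (N x))" by metis
  define g where "g x = snd (s (N x)) x" for x
  \<comment> \<open>Stages extend each other, so every stage whose domain contains \<open>x\<close>
    gives the same value.\<close>
  have g: "g x = snd (s n) x" if "x \<in> fst (s n)" for x n
    using ext[of n "N x"] ext[of "N x" n] that N[of x]
    by (cases "n \<le> N x") (auto simp: g_def ext_def)
  have "surj g"
  proof (rule surjI)
    fix y
    obtain n where "y = d n" using d by (metis surjD)
    then have "\<exists>x. g x = y" using s(5)[of n] g by force
    then show "g (SOME x. g x = y) = y" by (rule someI_ex)
  qed
  moreover have "\<forall>x\<in>F0. g x = f0 x" using g[of _ 0] s(2) by auto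
  moreover have "\<exists>F'. F \<subseteq> F' \<and> K F' g" if "finite F" for F
  proof -
    \<comment> \<open>For empty \<open>F\<close> the value of \<open>Max\<close> is unspecified, but
      the inclusion is trivial.\<close>
    have "F \<subseteq> fst (s (Max (N ` F)))"
    proof
      fix x
      assume "x \<in> F"
      then have "N x \<le> Max (N ` F)" using that by simp
      then show "x \<in> fst (s (Max (N ` F)))" using ext N[of x] unfolding ext_def by blast
    qed
    moreover have "K (fst (s (Max (N ` F)))) g"
      using s(1) g unfolding good_def by (blast intro: cong)
    ultimately show ?thesis by blast
  qed
  ultimately show ?thesis by blast
qed

text \<open>Each bound found lies in \<open>S\<close> again, so it can be paired with the next
  element. In the interpolation lemmas \<open>S\<close> holds the constraints from the opposite
  side.\<close>

lemma filtered_finite: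
  assumes "transp R"
    and pair: "\<And>b b'. S b \<Longrightarrow> S b' \<Longrightarrow> \<exists>m. S m \<and> R m b \<and> R m b'"
    and "finite B" "B \<noteq> {}" "\<And>b. b \<in> B \<Longrightarrow> S b"
  shows "\<exists>m. S m \<and> (\<forall>b\<in>B. R m b)"
  using assms(3-5)
proof (induction rule: finite_ne_induct)
  case (singleton x)
  then show ?case using pair[of x x] by auto
next
  case (insert x B)
  then obtain m where m: "S m" "\<forall>b\<in>B. R m b" by auto
  then obtain m' where "S m'" "R m' m" "R m' x" using pair insert.prems by blast
  then show ?case using m \<open>transp R\<close> by (auto dest: transpD)
qed

lemma finite_chain_has_top:
  fixes A :: "'a::order set"
  assumes "finite A" "A \<noteq> {}" "\<And>x y. x \<in> A \<Longrightarrow> y \<in> A \<Longrightarrow> x \<le> y \<or> y \<le> x"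
  shows "\<exists>m\<in>A. \<forall>x\<in>A. x \<le> m"
  using finite_has_maximal[OF assms(1,2)] assms(3) by metis

lemma finite_chain_has_bot:
  fixes A :: "'a::order set"
  assumes "finite A" "A \<noteq> {}" "\<And>x y. x \<in> A \<Longrightarrow> y \<in> A \<Longrightarrow> x \<le> y \<or> y \<le> x"
  shows "\<exists>m\<in>A. \<forall>x\<in>A. m \<le> x"
  using finite_has_minimal[OF assms(1,2)] assms(3) by metis

text \<open>
  A finite partial isomorphism is given by the set of its argument-value pairs, which is
  single-valued because the order is antisymmetric.
\<close>

lemma is_XY_partial_I_graph:
  fixes G :: "('a::order \<times> 'a) set"
  assumes "is_XY TYPE('a) partial_I Y" "finite G"
    and iso: "\<forall>(p, q)\<in>G. \<forall>(p', q')\<in>G. p \<le> p' \<longleftrightarrow> q \<le> q'"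
  shows "\<exists>g. Y g \<and> (\<forall>(p, q)\<in>G. g p = q)"
proof -
  define f where "f p = (SOME q. (p, q) \<in> G)" for p
  have f: "(p, f p) \<in> G" if "p \<in> fst ` G" for p
    using that unfolding f_def by (auto intro: someI)
  have f_le: "f p \<le> f p' \<longleftrightarrow> p \<le> p'" if "p \<in> fst ` G" "p' \<in> fst ` G" for p p'
    using f[OF that(1)] f[OF that(2)] iso by blast
  then have "inj_on f (fst ` G)"
    by (metis antisym inj_onI order_refl)
  then have "partial_I (fst ` G) f"
    using f_le by (simp add: partial_I_def bij_betw_def)
  then obtain g where g: "Y g" "\<forall>x\<in>fst ` G. g x = f x"
    using assms(1,2) unfolding is_XY_def by (meson finite_imageI)
  have "f p = q" if "(p, q) \<in> G" for p q
  proof (rule antisym)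
    have "(p, f p) \<in> G" using f that by force
    then show "f p \<le> q" "q \<le> f p" using that iso by blast+
  qed
  then show ?thesis using g by force
qed

lemma less_imp_not_ge: "(x :: 'a::order) < y \<Longrightarrow> \<not> y \<le> x"
  by (simp add: less_le_not_le)

text \<open>
  The non-strict and the strict case are treated together, with \<open>R\<close> being \<open>\<le>\<close> or \<open><\<close>.
\<close>

locale homogeneous_order =
  fixes R :: "'a::order \<Rightarrow> 'a \<Rightarrow> bool"
  assumes R_cases: "R = (\<le>) \<or> R = (<)"
    and IR: "is_XY TYPE('a) partial_I (monotone R R)"
    and IE: "is_XY TYPE('a) partial_I total_Ebar"
    and V: "\<exists>a b c :: 'a. a < b \<and> a < c \<and> \<not> b \<le> c \<and> \<not> c \<le> b"
    and L: "\<exists>a b c :: 'a. b < a \<and> c < a \<and> \<not> b \<le> c \<and> \<not> c \<le> b"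
    and Z: "\<exists>a b c :: 'a. a < b \<and> \<not> a \<le> c \<and> \<not> c \<le> a \<and> \<not> b \<le> c \<and> \<not> c \<le> b"
begin

lemma less_imp_R: "x < y \<Longrightarrow> R x y"
  using R_cases by auto

lemma R_imp_le: "R x y \<Longrightarrow> x \<le> y"
  using R_cases by auto

lemma le_R_trans: "x \<le> y \<Longrightarrow> R y z \<Longrightarrow> R x z"
  using R_cases by auto

lemma R_le_trans: "R x y \<Longrightarrow> y \<le> z \<Longrightarrow> R x z"
  using R_cases by auto

lemma transp_R: "transp R" "transp (\<lambda>x y. R y x)"
  by (auto intro!: transpI intro: le_R_trans R_imp_le)

lemma monotone_R_le: "monotone_on F R R f \<Longrightarrow> x \<in> F \<Longrightarrow> y \<in> F \<Longrightarrow> x \<le> y \<Longrightarrow> f x \<le> f y"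
  using R_imp_le less_imp_R by (metis monotone_onD order.order_iff_strict)

lemmas extend = is_XY_partial_I_graph[OF IR]
lemmas extend_surj = is_XY_partial_I_graph[OF IE, unfolded total_Ebar_def]

section \<open>Bounds and incomparable points\<close>

text \<open>An incomparable pair is isomorphic to the two upper points of V, and an extension of
  that isomorphism sends the lowest point of V to a lower bound.\<close>

lemma lower_bound_pair: "\<exists>l. l \<le> x \<and> l \<le> (y::'a)"
proof (cases "x \<le> y \<or> y \<le> x")
  case False
  obtain a b c :: 'a where abc: "a < b" "a < c" "\<not> b \<le> c" "\<not> c \<le> b" using V by blast
  then obtain g where g: "monotone R R g" "g b = x" "g c = y"
    using extend[of "{(b, x), (c, y)}"] False by auto
  then show ?thesis
    using monotone_R_le[OF g(1)] abc by (metis UNIV_I less_imp_le)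
qed auto

lemma upper_bound_pair: "\<exists>u. x \<le> u \<and> (y::'a) \<le> u"
proof (cases "x \<le> y \<or> y \<le> x")
  case False
  obtain a b c :: 'a where abc: "b < a" "c < a" "\<not> b \<le> c" "\<not> c \<le> b" using L by blast
  then obtain g where g: "monotone R R g" "g b = x" "g c = y"
    using extend[of "{(b, x), (c, y)}"] False by auto
  then show ?thesis
    using monotone_R_le[OF g(1)] abc by (metis UNIV_I less_imp_le)
qed auto

text \<open>A minimal point would be least, since pairs have lower bounds. A monotone surjection
  sends it to a least point, yet its image can be prescribed as some \<open>b\<close> with a point
  below it.\<close>

lemma no_min: "\<exists>l. l < (x::'a)"
proof (rule ccontr)
  assume "\<nexists>l. l < x"
  then have least: "x \<le> y" for y
    using lower_bound_pair[of x y] by (metis order.order_iff_strict)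
  obtain a b :: 'a where "a < b" using V by blast
  moreover obtain g where "surj g" "mono g" "g x = b"
    using extend_surj[of "{(x, b)}"] by auto
  ultimately show False
    using least by (metis leD monoD surjD)
qed

lemma no_max: "\<exists>u. (x::'a) < u"
proof (rule ccontr)
  assume "\<nexists>u. x < u"
  then have greatest: "y \<le> x" for y
    using upper_bound_pair[of x y] by (metis order.order_iff_strict)
  obtain a b :: 'a where "a < b" using V by blast
  moreover obtain g where "surj g" "mono g" "g x = a"
    using extend_surj[of "{(x, a)}"] by auto
  ultimately show False
    using greatest by (metis leD monoD surjD)
qed

lemma lower_bound:
  assumes "finite (B :: 'a set)" shows "\<exists>l. \<forall>b\<in>B. l < b"
proof (cases "B = {}")
  case False
  have "\<exists>m. m < b \<and> m < b'" for b b' :: 'a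
    using lower_bound_pair[of b b'] no_min by (metis order.strict_trans2)
  then show ?thesis
    using filtered_finite[of "(<)" "\<lambda>_. True" B] assms False by auto
qed auto

lemma upper_bound:
  assumes "finite (A :: 'a set)" shows "\<exists>u. \<forall>a\<in>A. a < u"
proof (cases "A = {}")
  case False
  have "\<exists>m. a < m \<and> a' < m" for a a' :: 'a
    using upper_bound_pair[of a a'] no_max by (metis order.strict_trans1)
  then show ?thesis
    using filtered_finite[of "(>)" "\<lambda>_. True" A] assms False by auto
qed auto

lemma incomparable:
  assumes "finite (F :: 'a set)"
  shows "\<exists>x. \<forall>a\<in>F. \<not> x \<le> a \<and> \<not> a \<le> x"
proof -
  \<comment> \<open>The arbitrary point \<open>undefined\<close> makes the set nonempty, so
    \<open>l < u\<close> follows even for empty \<open>F\<close>.\<close>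
  obtain l u where l: "\<forall>a\<in>insert undefined F. l < a" and u: "\<forall>a\<in>insert undefined F. a < u"
    using lower_bound[of "insert undefined F"] upper_bound[of "insert undefined F"] assms
    by (meson finite.insertI)
  then have "l < u" by (meson insertI1 less_trans)
  obtain a b c :: 'a where abc: "a < b" "\<not> a \<le> c" "\<not> c \<le> a" "\<not> b \<le> c" "\<not> c \<le> b"
    using Z by blast
  then obtain g where g: "surj g" "mono g" "g l = a" "g u = b"
    using extend_surj[of "{(l, a), (u, b)}"] \<open>l < u\<close>
    by (auto simp: less_imp_le less_imp_not_ge)
  then obtain x where "g x = c" by (metis surjD)
  \<comment> \<open>A point of \<open>F\<close> above \<open>x\<close> would put \<open>x\<close>
    below \<open>u\<close>; a point of \<open>F\<close> below \<open>x\<close> would put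
    \<open>x\<close> above \<open>l\<close>.\<close>
  then have "\<not> x \<le> u" "\<not> l \<le> x" using abc g by (auto dest: monoD)
  then show ?thesis using l u by (meson insertCI less_imp_le order_trans)
qed

section \<open>Interpolation between finite sets\<close>

text \<open>For strict \<open>R\<close>, choose \<open>k < l\<close> below \<open>b\<close> and
  \<open>b'\<close>, send \<open>k\<close> to \<open>a\<close> and fix \<open>b\<close> and
  \<open>b'\<close>; the image of \<open>l\<close> interpolates. Comparable \<open>b\<close>,
  \<open>b'\<close> reduce to the smaller one.\<close>

lemma interpolate_below_pair:
  assumes "R a b" "R a b'"
  shows "\<exists>m. R a m \<and> R m b \<and> R m b'"
proof (cases "R = (<)")
  case strict: True
  have chain: "\<exists>m. R a m \<and> R m b" if ab: "R a b" for b
  proof -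
    obtain k l where "k < l" "l < b" using no_min by metis
    moreover from this obtain g where "monotone R R g" "g k = a" "g b = b"
      using extend[of "{(k, a), (b, b)}"] ab strict
      by (auto simp: less_imp_le less_imp_not_ge)
    ultimately show ?thesis using strict by (metis monotoneD)
  qed
  show ?thesis
  proof (cases "b \<le> b' \<or> b' \<le> b")
    case True
    then show ?thesis using chain[of b] chain[of b'] assms R_le_trans by blast
  next
    case False
    obtain l where l: "l < b" "l < b'" using lower_bound[of "{b,b'}"] by auto
    obtain k where k: "k < l" using no_min by blast
    then have "k < b" "k < b'" using l by auto
    then obtain g where "monotone R R g" "g k = a" "g b = b" "g b' = b'"
      using extend[of "{(k, a), (b, b), (b', b')}"] assms strict False
      by (auto simp: less_imp_le less_imp_not_ge)
    then show ?thesis using l k strict by (metis monotoneD)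
  qed
qed (use R_cases assms in auto)

lemma interpolate_above_pair:
  assumes "R a b" "R a' b"
  shows "\<exists>m. R a m \<and> R a' m \<and> R m b"
proof (cases "R = (<) \<and> \<not> a \<le> a' \<and> \<not> a' \<le> a")
  case True
  then have strict: "R = (<)" by blast
  obtain l where l: "a < l" "a' < l" using upper_bound[of "{a,a'}"] by auto
  obtain k where k: "l < k" using no_max by blast
  then have "a < k" "a' < k" using l by auto
  then obtain g where "monotone R R g" "g k = b" "g a = a" "g a' = a'"
    using extend[of "{(k, b), (a, a), (a', a')}"] assms True
    by (auto simp: less_imp_le less_imp_not_ge)
  then show ?thesis using l k strict by (metis monotoneD)
next
  case False
  then consider "R = (\<le>)" | "a \<le> a'" | "a' \<le> a" using R_cases by blast
  then show ?thesis
    using interpolate_below_pair[of a b b] interpolate_below_pair[of a' b b] assms le_R_trans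
    by cases blast+
qed

text \<open>The centre of an X-shaped subposet: an extension of a map on the four outer points sends
  it to an interpolant.\<close>

definition saddle :: "'a \<Rightarrow> bool"
  where "saddle m \<longleftrightarrow> (\<exists>a a' b b'. a < m \<and> a' < m \<and> m < b \<and> m < b' \<and>
    \<not> a \<le> a' \<and> \<not> a' \<le> a \<and> \<not> b \<le> b' \<and> \<not> b' \<le> b)"

text \<open>If one of the pairs is comparable, the one-sided lemmas suffice. Otherwise the four
  points are isomorphic to the outer points of the X at \<open>s\<close>, and the image of
  \<open>s\<close> lies between them.\<close>

lemma interpolate_pairs:
  assumes "saddle s" "R a b" "R a b'" "R a' b" "R a' b'"
  shows "\<exists>m. R a m \<and> R a' m \<and> R m b \<and> R m b'"
proof -
  consider "a \<le> a' \<or> a' \<le> a" | "b \<le> b' \<or> b' \<le> b"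
    | "\<not> a \<le> a'" "\<not> a' \<le> a" "\<not> b \<le> b'" "\<not> b' \<le> b" by blast
  then show ?thesis
  proof cases
    case 1
    then show ?thesis
      using interpolate_below_pair[of a b b'] interpolate_below_pair[of a' b b'] assms le_R_trans
      by blast
  next
    case 2
    then show ?thesis
      using interpolate_above_pair[of a b a'] interpolate_above_pair[of a b' a'] assms R_le_trans
      by blast
  next
    case 3
    \<comment> \<open>An equality across the pairs, such as \<open>a = b\<close>, would make
      \<open>a'\<close> comparable to \<open>a\<close>.\<close>
    have less: "a < b" "a < b'" "a' < b" "a' < b'"
      using assms 3 R_imp_le by (metis order.order_iff_strict)+
    obtain p p' q q' where s: "p < s" "p' < s" "s < q" "s < q'"
      "\<not> p \<le> p'" "\<not> p' \<le> p" "\<not> q \<le> q'" "\<not> q' \<le> q"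
      using assms(1) by (auto simp: saddle_def)
    then have "p < q" "p < q'" "p' < q" "p' < q'" by auto
    then obtain g where g: "monotone R R g" "g p = a" "g p' = a'" "g q = b" "g q' = b'"
      using extend[of "{(p, a), (p', a'), (q, b), (q', b')}"] 3 s less
      by (auto simp: less_imp_le less_imp_not_ge)
    then show ?thesis using s by (metis less_imp_R monotoneD)
  qed
qed

text \<open>The saddle may lie anywhere, since homogeneity transports it. Hence the condition passes
  to images under monotone maps, which send chains to chains.\<close>

definition interpolable :: "'a set \<Rightarrow> 'a set \<Rightarrow> bool"
  where "interpolable A B \<longleftrightarrow> Ex saddle \<or> (\<forall>x\<in>A. \<forall>y\<in>A. x \<le> y \<or> y \<le> x) \<or>
    (\<forall>x\<in>B. \<forall>y\<in>B. x \<le> y \<or> y \<le> x)"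

lemma interpolate_nonempty:
  assumes fin: "finite A" "finite B" "A \<noteq> {}" "B \<noteq> {}"
    and AB: "\<And>a b. a \<in> A \<Longrightarrow> b \<in> B \<Longrightarrow> R a b"
    and "interpolable A B"
  shows "\<exists>m. (\<forall>a\<in>A. R a m) \<and> (\<forall>b\<in>B. R m b)"
proof -
  consider s where "saddle s" | a where "a \<in> A" "\<forall>x\<in>A. x \<le> a" | b where "b \<in> B" "\<forall>x\<in>B. b \<le> x"
    using assms(6) finite_chain_has_top[OF fin(1,3)] finite_chain_has_bot[OF fin(2,4)]
    unfolding interpolable_def by metis
  then show ?thesis
  proof cases
    case 1
    \<comment> \<open>The two sides are treated in turn: first \<open>B\<close>, within the points
      above \<open>a\<close> and \<open>a'\<close>; then \<open>A\<close>, within the points below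
      all of \<open>B\<close>.\<close>
    have "\<exists>m. (R a m \<and> R a' m) \<and> (\<forall>b\<in>B. R m b)"
      if aa': "\<forall>b\<in>B. R a b" "\<forall>b\<in>B. R a' b" for a a'
    proof (rule filtered_finite[OF transp_R(1) _ fin(2,4)])
      show "\<exists>m. (R a m \<and> R a' m) \<and> R m b \<and> R m b'"
        if "R a b \<and> R a' b" "R a b' \<and> R a' b'" for b b'
        using interpolate_pairs[OF 1, of a b b' a'] that by blast
    qed (use aa' in blast)
    then show ?thesis
      using filtered_finite[OF transp_R(2) _ fin(1,3), of "\<lambda>m. \<forall>b\<in>B. R m b"] AB by blast
  next
    case 2
    then have "\<exists>m. R a m \<and> (\<forall>b\<in>B. R m b)"
      using filtered_finite[OF transp_R(1) _ fin(2,4), of "R a"] interpolate_below_pair AB by blast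
    then show ?thesis using 2 le_R_trans by blast
  next
    case 3
    then have "\<exists>m. R m b \<and> (\<forall>a\<in>A. R a m)"
      using filtered_finite[OF transp_R(2) _ fin(1,3), of "\<lambda>m. R m b"] interpolate_above_pair AB
      by blast
    then show ?thesis using 3 R_le_trans by blast
  qed
qed

lemma interpolate:
  assumes fin: "finite A" "finite B"
    and AB: "\<And>a b. a \<in> A \<Longrightarrow> b \<in> B \<Longrightarrow> R a b"
    and int: "interpolable A B"
  shows "\<exists>m. (\<forall>a\<in>A. R a m) \<and> (\<forall>b\<in>B. R m b)"
  using interpolate_nonempty[OF fin _ _ AB int] lower_bound[OF fin(2)] upper_bound[OF fin(1)]
    less_imp_R by (metis empty_iff)

text \<open>If only finitely many points interpolated, a maximal one could be added to
  \<open>A\<close>, and interpolating once more would give a strictly larger one.\<close>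

lemma interpolate_avoiding:
  assumes strict: "R = (<)" and fin: "finite A" "finite B" "finite S"
    and AB: "\<And>a b. a \<in> A \<Longrightarrow> b \<in> B \<Longrightarrow> R a b"
    and int: "interpolable A B"
  shows "\<exists>m. m \<notin> S \<and> (\<forall>a\<in>A. R a m) \<and> (\<forall>b\<in>B. R m b)"
proof (rule ccontr)
  let ?I = "{m. (\<forall>a\<in>A. R a m) \<and> (\<forall>b\<in>B. R m b)}"
  assume "\<not> ?thesis"
  then have "finite ?I" by (intro finite_subset[OF _ fin(3)]) auto
  moreover have "?I \<noteq> {}" using interpolate[OF fin(1,2) AB int] by auto
  ultimately obtain m where m: "m \<in> ?I" "\<forall>m'\<in>?I. m \<le> m' \<longrightarrow> m = m'"
    using finite_has_maximal[of ?I] by blast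
  \<comment> \<open>Since \<open>m\<close> lies above \<open>A\<close>, adding it keeps
    \<open>A\<close> a chain if it was one.\<close>
  have "\<forall>a\<in>A. a \<le> m" using m R_imp_le by blast
  then have "interpolable (insert m A) B" using int unfolding interpolable_def by auto
  then obtain m' where "\<forall>a\<in>insert m A. R a m'" "\<forall>b\<in>B. R m' b"
    using interpolate[OF finite.insertI[OF fin(1)] fin(2), of m] m(1) AB by blast
  then show False using m strict by auto
qed

section \<open>One-point extensions and their limits\<close>

lemma monotone_on_update:
  assumes "monotone_on F R R f" "x \<notin> F"
    and "\<And>a. a \<in> F \<Longrightarrow> a < x \<Longrightarrow> R (f a) y" "\<And>b. b \<in> F \<Longrightarrow> x < b \<Longrightarrow> R y (f b)"
  shows "monotone_on (insert x F) R R (f(x := y))"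
proof (rule monotone_onI)
  fix u v
  assume uv: "u \<in> insert x F" "v \<in> insert x F" "R u v"
  then have "u < v \<or> u = v" "u = v \<longrightarrow> R = (\<le>)" using R_cases by auto
  then show "R ((f(x := y)) u) ((f(x := y)) v)"
    using uv assms by (auto dest: monotone_onD)
qed

text \<open>If \<open>x\<close> is not a saddle, the points of \<open>F\<close> below it or those
  above it form a chain. The set \<open>S\<close> of forbidden values serves injectivity.\<close>

lemma forth_step:
  assumes "finite F" "finite S" "monotone_on F R R f" "x \<notin> F"
  shows "\<exists>y. monotone_on (insert x F) R R (f(x := y)) \<and> (R = (<) \<longrightarrow> y \<notin> S)"
proof -
  let ?A = "{a\<in>F. a < x}" and ?B = "{b\<in>F. x < b}"
  have "interpolable ?A ?B"
  proof (cases "saddle x")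
    case False
    then show ?thesis
      unfolding interpolable_def saddle_def by (metis (no_types, lifting) mem_Collect_eq)
  qed (auto simp: interpolable_def)
  then have "interpolable (f ` ?A) (f ` ?B)"
    unfolding interpolable_def ball_simps(9)
    using monotone_R_le[OF assms(3)] by (elim disj_forward) blast+
  moreover have "R a b" if "a \<in> f ` ?A" "b \<in> f ` ?B" for a b
    using that assms(3) less_imp_R by (auto intro!: monotone_onD[OF assms(3)])
  moreover have "finite (f ` ?A)" "finite (f ` ?B)" using assms(1) by auto
  ultimately obtain y where "\<forall>a\<in>f ` ?A. R a y" "\<forall>b\<in>f ` ?B. R y b" "R = (<) \<longrightarrow> y \<notin> S"
    using interpolate[of "f ` ?A" "f ` ?B"] interpolate_avoiding[of "f ` ?A" "f ` ?B" S] assms(2)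
    by (metis (no_types, lifting))
  then show ?thesis
    using monotone_on_update[OF assms(3,4), of y] by (intro exI[of _ y]) auto
qed

text \<open>A new argument incomparable to all of \<open>F\<close> leaves its value \<open>y\<close>
  unconstrained.\<close>

lemma back_step:
  assumes "finite F" "monotone_on F R R f"
  shows "\<exists>x. x \<notin> F \<and> monotone_on (insert x F) R R (f(x := y))"
proof -
  obtain x where "\<forall>a\<in>F. \<not> x \<le> a \<and> \<not> a \<le> x" using incomparable[OF assms(1)] by blast
  then show ?thesis
    using monotone_on_update[OF assms(2), of x y] less_imp_le by (metis order_refl)
qed

lemma monotone_if_locally:
  assumes "\<And>F. finite F \<Longrightarrow> \<exists>F'. F \<subseteq> F' \<and> monotone_on F' R R g"
  shows "monotone R R g"
proof (rule monotoneI)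
  fix x y
  assume "R x y"
  then show "R (g x) (g y)"
    using assms[of "{x, y}"] by (auto dest: monotone_onD)
qed

lemma extend_to_surj:
  assumes "countable (UNIV :: 'a set)" "finite F" "monotone_on F R R f"
  shows "\<exists>g. surj g \<and> monotone R R g \<and> (\<forall>x\<in>F. g x = f x)"
proof -
  \<comment> \<open>Values may repeat here, so the set of values to avoid is empty.\<close>
  have "\<exists>g. surj g \<and> (\<forall>x\<in>F. g x = f x) \<and>
      (\<forall>F. finite F \<longrightarrow> (\<exists>F'. F \<subseteq> F' \<and> monotone_on F' R R g))"
    using assms forth_step[OF _ finite.emptyI] back_step
    by (intro back_and_forth) (auto simp: monotone_on_def)
  then show ?thesis using monotone_if_locally by blast
qed

lemma extend_to_bij:
  assumes "R = (<)" "countable (UNIV :: 'a set)" "finite F" "inj_on f F" "monotone_on F R R f"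
  shows "\<exists>g. bij g \<and> monotone R R g \<and> (\<forall>x\<in>F. g x = f x)"
proof -
  let ?K = "\<lambda>F f. inj_on f F \<and> monotone_on F R R f"
  have "\<exists>g. surj g \<and> (\<forall>x\<in>F. g x = f x) \<and> (\<forall>F. finite F \<longrightarrow> (\<exists>F'. F \<subseteq> F' \<and> ?K F' g))"
  proof (rule back_and_forth)
    \<comment> \<open>Injectivity survives both steps: here the old values are avoided, and the back
      step is only asked for a \<open>y\<close> outside the range.\<close>
    show "\<exists>y. ?K (insert x F) (f(x := y))" if "finite F" "?K F f" "x \<notin> F" for F f x
      using forth_step[of F "f ` F" f x] that assms(1) by (fastforce simp: inj_on_def)
    show "\<exists>x. x \<notin> F \<and> ?K (insert x F) (f(x := y))" if "finite F" "?K F f" "y \<notin> f ` F" for F f y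
      using back_step[of F f y] that by (fastforce simp: inj_on_def)
    show "?K F g" if "?K F f" "\<And>x. x \<in> F \<Longrightarrow> g x = f x" for F f g
      using that by (auto simp: monotone_on_def inj_on_def)
  qed (use assms in auto)
  then obtain g where g: "surj g" "\<forall>x\<in>F. g x = f x"
    "\<And>F. finite F \<Longrightarrow> \<exists>F'. F \<subseteq> F' \<and> ?K F' g" by blast
  have "inj g"
  proof (rule injI)
    fix x y
    assume "g x = g y"
    then show "x = y" using g(3)[of "{x, y}"] by (auto dest: inj_onD)
  qed
  then show ?thesis using g monotone_if_locally by (meson bijI)
qed

end

section \<open>From the embedded posets to the theorem\<close>

lemma embeds_poset_VD:
  assumes "embeds TYPE('a::order) poset_V"
  shows "\<exists>a b c :: 'a. a < b \<and> a < c \<and> \<not> b \<le> c \<and> \<not> c \<le> b"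
proof -
  obtain f :: "nat \<Rightarrow> 'a" where
    "\<forall>x\<in>{0,1,2}. \<forall>y\<in>{0,1,2}. (x, y) \<in> poset_V \<longleftrightarrow> f x \<le> f y"
    using assms by (auto simp: embeds_def Field_small_posets)
  then show ?thesis
    by (intro exI[of _ "f 0"] exI[of _ "f 1"] exI[of _ "f 2"])
      (simp add: poset_V_def less_le_not_le Id_on_iff)
qed

lemma embeds_poset_LambdaD:
  assumes "embeds TYPE('a::order) poset_Lambda"
  shows "\<exists>a b c :: 'a. b < a \<and> c < a \<and> \<not> b \<le> c \<and> \<not> c \<le> b"
proof -
  obtain f :: "nat \<Rightarrow> 'a" where
    "\<forall>x\<in>{0,1,2}. \<forall>y\<in>{0,1,2}. (x, y) \<in> poset_Lambda \<longleftrightarrow> f x \<le> f y"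
    using assms by (auto simp: embeds_def Field_small_posets)
  then show ?thesis
    by (intro exI[of _ "f 0"] exI[of _ "f 1"] exI[of _ "f 2"])
      (simp add: poset_Lambda_def less_le_not_le Id_on_iff)
qed

lemma embeds_poset_ZD:
  assumes "embeds TYPE('a::order) poset_Z"
  shows "\<exists>a b c :: 'a. a < b \<and> \<not> a \<le> c \<and> \<not> c \<le> a \<and> \<not> b \<le> c \<and> \<not> c \<le> b"
proof -
  obtain f :: "nat \<Rightarrow> 'a" where
    "\<forall>x\<in>{0,1,2}. \<forall>y\<in>{0,1,2}. (x, y) \<in> poset_Z \<longleftrightarrow> f x \<le> f y"
    using assms by (auto simp: embeds_def Field_small_posets)
  then show ?thesis
    by (intro exI[of _ "f 0"] exI[of _ "f 1"] exI[of _ "f 2"])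
      (simp add: poset_Z_def less_le_not_le Id_on_iff)
qed

theorem theorem2p13:
  assumes "countable (UNIV :: ('a::order) set)"
    and "is_XY TYPE('a) partial_I total_Ebar"
    and "embeds TYPE('a) poset_V"
    and "embeds TYPE('a) poset_Lambda"
    and "embeds TYPE('a) poset_Z"
  shows "(is_XY TYPE('a) partial_I total_Hbar \<longrightarrow> is_XY TYPE('a) partial_Hbar total_Ebar) \<and>
    (is_XY TYPE('a) partial_I total_H \<longrightarrow>
      is_XY TYPE('a) partial_H total_E \<and> is_XY TYPE('a) partial_M total_B)"
proof (intro conjI impI)
  note embedded = assms(2) embeds_poset_VD[OF assms(3)] embeds_poset_LambdaD[OF assms(4)]
    embeds_poset_ZD[OF assms(5)]
  {
    assume "is_XY TYPE('a) partial_I total_Hbar"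
    \<comment> \<open>For this \<open>R\<close>, \<open>monotone_on\<close> is
      \<open>mono_on\<close>; for the strict order below it is
      \<open>strict_mono_on\<close>.\<close>
    then interpret homogeneous_order "(\<le>) :: 'a \<Rightarrow> 'a \<Rightarrow> bool"
      using embedded by unfold_locales (auto simp: is_XY_def total_Hbar_def)
    show "is_XY TYPE('a) partial_Hbar total_Ebar"
      using extend_to_surj[OF assms(1)]
      unfolding is_XY_def partial_Hbar_def total_Ebar_def by blast
  next
    assume "is_XY TYPE('a) partial_I total_H"
    then interpret homogeneous_order "(<) :: 'a \<Rightarrow> 'a \<Rightarrow> bool"
      using embedded by unfold_locales (auto simp: is_XY_def total_H_def)
    show "is_XY TYPE('a) partial_H total_E"
      using extend_to_surj[OF assms(1)]
      unfolding is_XY_def partial_H_def total_E_def by blast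
    show "is_XY TYPE('a) partial_M total_B"
      using extend_to_bij[OF refl assms(1)]
      unfolding is_XY_def partial_M_def total_B_def by blast
  }
qed

end
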